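(* Let $X$ be a normal topological space. If $f \in \mathrm{USC}(X)$ and $g \in \mathrm{LSC}(X)$ satisfy $f \le g$ (pointwise on $X$), then there is $h \in C^*(X)$ such that $f \le h \le g$.
   Context: For a topological space $X$, $B(X)$ denotes the set of all bounded functions $X \to \mathbb{R}$, ordered pointwise, and $C^*(X) \subseteq B(X)$ the subset of bounded continuous functions. A function $f \in B(X)$ is upper semicontinuous if $f^{-1}(-\infty,\lambda)$ is open for all $\lambda \in \mathbb{R}$, and lower semicontinuous if $f^{-1}(\lambda,\infty)$ is open for all $\lambda \in \mathbb{R}$. $\mathrm{USC}(X)$ and $\mathrm{LSC}(X)$ denote the sets of bounded upper semicontinuous and bounded lower semicontinuous real-valued functions on $X$, respectively. *)

theory Defs
  imports "HOL-Analysis.Analysis"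
begin

text \<open>
  A space is an abstract topology \<open>X :: 'a topology\<close> with underlying set \<open>topspace X\<close>, and a
  function \<open>X \<rightarrow> \<real>\<close> is represented by a HOL function \<open>'a \<Rightarrow> real\<close>.
  Every condition below concerns its values on \<open>topspace X\<close> only; the values
  outside are irrelevant and unconstrained.
\<close>

definition bounded_functions :: "'a topology \<Rightarrow> ('a \<Rightarrow> real) set" where
  "bounded_functions X = {f. bounded (f ` topspace X)}"

definition bounded_continuous_functions :: "'a topology \<Rightarrow> ('a \<Rightarrow> real) set" where
  "bounded_continuous_functions X = {f \<in> bounded_functions X. continuous_map X euclideanreal f}"

definition USC :: "'a topology \<Rightarrow> ('a \<Rightarrow> real) set" where
  "USC X = {f \<in> bounded_functions X. \<forall>c. openin X {x \<in> topspace X. f x < c}}"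

definition LSC :: "'a topology \<Rightarrow> ('a \<Rightarrow> real) set" where
  "LSC X = {f \<in> bounded_functions X. \<forall>c. openin X {x \<in> topspace X. c < f x}}"

definition pointwise_le :: "'a topology \<Rightarrow> ('a \<Rightarrow> real) \<Rightarrow> ('a \<Rightarrow> real) \<Rightarrow> bool" where
  "pointwise_le X f g \<longleftrightarrow> (\<forall>x \<in> topspace X. f x \<le> g x)"

end

theory Submission
  imports Defs
begin

text \<open>
  Given \<open>\<epsilon> > 0\<close>, Urysohn functions for the disjoint closed sets \<open>{f \<ge> (i + 1)\<epsilon>}\<close> and
  \<open>{g \<le> i\<epsilon>}\<close>, for finitely many \<open>i\<close>, add up to a continuous \<open>h\<close> with
  \<open>f - \<epsilon> \<le> h \<le> g + \<epsilon>\<close>. The pair \<open>max f (h - \<epsilon>) \<le> min g (h + \<epsilon>)\<close> is again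
  semicontinuous, so the approximation can be repeated with \<open>\<epsilon>/2\<close> without moving \<open>h\<close> by more
  than \<open>3\<epsilon>/2\<close>; the uniform limit lies between \<open>f\<close> and \<open>g\<close>.
\<close>

text \<open>Induction on the number \<open>n\<close> of steps: shifting \<open>f\<close> and
  \<open>g\<close> down by \<open>\<epsilon>\<close> saves one step, and a Urysohn function with
  values between 0 and \<open>\<epsilon>\<close> pays for the shift. For \<open>g x \<le> 0\<close>
  the claim is \<open>h x = 0\<close> rather than a bound by \<open>g x + \<epsilon>\<close>, which
  may be negative; this vanishing is also what lets the next Urysohn function be added without
  overshooting.\<close>

lemma staircase_insertion:
  fixes f g :: "'a \<Rightarrow> real"
  assumes "normal_space X" and "\<epsilon> > 0"
    and "\<And>c. openin X {x \<in> topspace X. f x < c}"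
    and "\<And>c. openin X {x \<in> topspace X. c < g x}"
    and "\<And>x. x \<in> topspace X \<Longrightarrow> f x \<le> g x"
    and "\<And>x. x \<in> topspace X \<Longrightarrow> f x \<le> real n * \<epsilon>"
  shows "\<exists>h. continuous_map X euclideanreal h \<and>
           (\<forall>x \<in> topspace X. 0 \<le> h x \<and> f x - \<epsilon> \<le> h x \<and>
              (g x \<le> 0 \<longrightarrow> h x = 0) \<and> (0 < g x \<longrightarrow> h x \<le> g x + \<epsilon>))"
  using assms(3-)
proof (induction n arbitrary: f g)
  case 0
  with \<open>\<epsilon> > 0\<close> show ?case
    by (intro exI [of _ "\<lambda>x. 0"]) force
next
  case (Suc n)
  have "\<exists>h. continuous_map X euclideanreal h \<and>
           (\<forall>x \<in> topspace X. 0 \<le> h x \<and> (f x - \<epsilon>) - \<epsilon> \<le> h x \<and>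
              (g x - \<epsilon> \<le> 0 \<longrightarrow> h x = 0) \<and> (0 < g x - \<epsilon> \<longrightarrow> h x \<le> (g x - \<epsilon>) + \<epsilon>))"
  proof (rule Suc.IH)
    show "openin X {x \<in> topspace X. f x - \<epsilon> < c}" for c
      using Suc.prems(1) [of "c + \<epsilon>"] by (simp add: diff_less_eq)
    show "openin X {x \<in> topspace X. c < g x - \<epsilon>}" for c
      using Suc.prems(2) [of "c + \<epsilon>"] by (simp add: less_diff_eq)
  qed (use Suc.prems(3,4) in \<open>force simp: algebra_simps\<close>)+
  \<comment> \<open>Undoing the shift leaves an upper bound \<open>g x\<close> with
    \<open>\<epsilon>\<close> to spare, but a lower bound \<open>f x - 2 * \<epsilon>\<close> that
    is too weak by \<open>\<epsilon>\<close>. The function \<open>u\<close> below makes up for this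
    where \<open>\<epsilon> \<le> f x\<close>.\<close>
  then obtain k where contk: "continuous_map X euclideanreal k"
    and k: "\<And>x. x \<in> topspace X \<Longrightarrow> 0 \<le> k x \<and> f x - 2 * \<epsilon> \<le> k x \<and>
              (g x \<le> \<epsilon> \<longrightarrow> k x = 0) \<and> (\<epsilon> < g x \<longrightarrow> k x \<le> g x)"
    by fastforce
  have "topspace X - {x \<in> topspace X. 0 < g x} = {x \<in> topspace X. g x \<le> 0}"
    "topspace X - {x \<in> topspace X. f x < \<epsilon>} = {x \<in> topspace X. \<epsilon> \<le> f x}"
    by auto
  then have "closedin X {x \<in> topspace X. g x \<le> 0}" "closedin X {x \<in> topspace X. \<epsilon> \<le> f x}"
    using Suc.prems(1,2) by (metis openin_closedin_eq)+
  moreover have "disjnt {x \<in> topspace X. g x \<le> 0} {x \<in> topspace X. \<epsilon> \<le> f x}"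
    using Suc.prems(3) \<open>\<epsilon> > 0\<close> by (force simp: disjnt_iff)
  ultimately obtain u where contu: "continuous_map X (top_of_set {0..\<epsilon>}) u"
    and u0: "u ` {x \<in> topspace X. g x \<le> 0} \<subseteq> {0}"
    and u1: "u ` {x \<in> topspace X. \<epsilon> \<le> f x} \<subseteq> {\<epsilon>}"
    by (rule Urysohn_lemma [OF \<open>normal_space X\<close> _ _ _ less_imp_le [OF \<open>\<epsilon> > 0\<close>]])
  have contu': "continuous_map X euclideanreal u"
    and u: "\<And>x. x \<in> topspace X \<Longrightarrow> 0 \<le> u x \<and> u x \<le> \<epsilon>"
    using contu by (auto simp: continuous_map_in_subtopology)
  show ?case
  proof (intro exI [of _ "\<lambda>x. k x + u x"] conjI ballI)
    show "continuous_map X euclideanreal (\<lambda>x. k x + u x)"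
      by (intro continuous_intros contk contu')
    fix x assume x: "x \<in> topspace X"
    have "g x \<le> 0 \<Longrightarrow> u x = 0" "\<epsilon> \<le> f x \<Longrightarrow> u x = \<epsilon>"
      using u0 u1 x by auto
    \<comment> \<open>Lower bound: if \<open>f x < \<epsilon>\<close>, nonnegativity suffices;
      otherwise \<open>u x = \<epsilon>\<close>. Upper bound: if
      \<open>0 < g x \<le> \<epsilon>\<close>, then \<open>k x = 0\<close> and only
      \<open>u x \<le> \<epsilon>\<close> counts; beyond that, \<open>k x \<le> g x\<close>.\<close>
    then show "0 \<le> k x + u x" "f x - \<epsilon> \<le> k x + u x" "g x \<le> 0 \<longrightarrow> k x + u x = 0"
      "0 < g x \<longrightarrow> k x + u x \<le> g x + \<epsilon>"
      using k [OF x] u [OF x] \<open>\<epsilon> > 0\<close> by linarith+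
  qed
qed

text \<open>Boundedness reduces this to the staircase: adding a bound \<open>C\<close> of
  \<open>g\<close> makes \<open>g\<close> nonnegative, and a bound of \<open>f\<close> limits the
  number of steps.\<close>

lemma approximate_insertion:
  fixes f g :: "'a \<Rightarrow> real"
  assumes X: "normal_space X" and "\<epsilon> > 0" and f: "f \<in> USC X" and g: "g \<in> LSC X"
    and le: "pointwise_le X f g"
  obtains h where "h \<in> bounded_continuous_functions X"
    and "\<And>x. x \<in> topspace X \<Longrightarrow> f x - \<epsilon> \<le> h x \<and> h x \<le> g x + \<epsilon>"
proof -
  obtain B where B: "\<And>x. x \<in> topspace X \<Longrightarrow> \<bar>f x\<bar> \<le> B"
    using f by (auto simp: USC_def bounded_functions_def bounded_iff)
  obtain C where C: "\<And>x. x \<in> topspace X \<Longrightarrow> \<bar>g x\<bar> \<le> C"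
    using g by (auto simp: LSC_def bounded_functions_def bounded_iff)
  obtain n where n: "B + C \<le> real n * \<epsilon>"
    using \<open>\<epsilon> > 0\<close> by (metis ex_less_of_nat_mult less_imp_le)
  have "\<exists>h. continuous_map X euclideanreal h \<and>
           (\<forall>x \<in> topspace X. 0 \<le> h x \<and> (f x + C) - \<epsilon> \<le> h x \<and>
              (g x + C \<le> 0 \<longrightarrow> h x = 0) \<and> (0 < g x + C \<longrightarrow> h x \<le> (g x + C) + \<epsilon>))"
  proof (rule staircase_insertion [OF X \<open>\<epsilon> > 0\<close>])
    show "openin X {x \<in> topspace X. f x + C < c}" for c
      using f by (simp add: USC_def flip: less_diff_eq)
    show "openin X {x \<in> topspace X. c < g x + C}" for c
      using g by (simp add: LSC_def flip: diff_less_eq)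
    show "f x + C \<le> g x + C" if "x \<in> topspace X" for x
      using le that by (simp add: pointwise_le_def)
    show "f x + C \<le> real n * \<epsilon>" if "x \<in> topspace X" for x
      using B [OF that] n by linarith
  qed
  then obtain h where conth: "continuous_map X euclideanreal h"
    and h: "\<And>x. x \<in> topspace X \<Longrightarrow> f x + C - \<epsilon> \<le> h x \<and>
              (g x + C \<le> 0 \<longrightarrow> h x = 0) \<and> (0 < g x + C \<longrightarrow> h x \<le> g x + C + \<epsilon>)"
    by blast
  \<comment> \<open>Since \<open>g x + C \<ge> 0\<close>, the case \<open>g x + C \<le> 0\<close>
    means equality, and there \<open>h x = 0\<close> meets the upper bound too.\<close>
  have *: "f x - \<epsilon> \<le> h x - C \<and> h x - C \<le> g x + \<epsilon>" if "x \<in> topspace X" for x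
    using h [OF that] C [OF that] \<open>\<epsilon> > 0\<close> by linarith
  have "\<bar>h x - C\<bar> \<le> B + C + \<epsilon>" if "x \<in> topspace X" for x
    using * [OF that] B [OF that] C [OF that] by linarith
  then have "bounded ((\<lambda>x. h x - C) ` topspace X)"
    by (auto simp: bounded_iff)
  moreover have "continuous_map X euclideanreal (\<lambda>x. h x - C)"
    by (intro continuous_map_diff conth) auto
  ultimately show thesis
    using that * by (simp add: bounded_continuous_functions_def bounded_functions_def)
qed

lemma bounded_image_max_min:
  fixes f g :: "'a \<Rightarrow> real"
  assumes "bounded (f ` S)" and "bounded (g ` S)"
  shows "bounded ((\<lambda>x. max (f x) (g x)) ` S)" and "bounded ((\<lambda>x. min (f x) (g x)) ` S)"
proof -
  obtain B C where "\<And>x. x \<in> S \<Longrightarrow> \<bar>f x\<bar> \<le> B" and "\<And>x. x \<in> S \<Longrightarrow> \<bar>g x\<bar> \<le> C"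
    using assms by (auto simp: bounded_iff)
  then have "\<And>x. x \<in> S \<Longrightarrow> \<bar>max (f x) (g x)\<bar> \<le> max B C \<and> \<bar>min (f x) (g x)\<bar> \<le> max B C"
    by (smt (verit))
  then show "bounded ((\<lambda>x. max (f x) (g x)) ` S)" "bounded ((\<lambda>x. min (f x) (g x)) ` S)"
    by (auto simp: bounded_iff)
qed

lemma USC_max:
  assumes "f \<in> USC X" and "g \<in> USC X"
  shows "(\<lambda>x. max (f x) (g x)) \<in> USC X"
proof -
  have "{x \<in> topspace X. max (f x) (g x) < c}
      = {x \<in> topspace X. f x < c} \<inter> {x \<in> topspace X. g x < c}" for c
    by auto
  with assms show ?thesis
    by (simp add: USC_def bounded_functions_def bounded_image_max_min openin_Int)
qed

lemma LSC_min:
  assumes "f \<in> LSC X" and "g \<in> LSC X"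
  shows "(\<lambda>x. min (f x) (g x)) \<in> LSC X"
proof -
  have "{x \<in> topspace X. c < min (f x) (g x)}
      = {x \<in> topspace X. c < f x} \<inter> {x \<in> topspace X. c < g x}" for c
    by auto
  with assms show ?thesis
    by (simp add: LSC_def bounded_functions_def bounded_image_max_min openin_Int)
qed

text \<open>This lets a continuous approximant enter both the maximum with \<open>f\<close> and the
  minimum with \<open>g\<close>.\<close>

lemma bounded_continuous_functions_eq: "bounded_continuous_functions X = USC X \<inter> LSC X"
  unfolding bounded_continuous_functions_def USC_def LSC_def
    continuous_map_upper_lower_semicontinuous_lt
  by blast

lemma bounded_continuous_functions_add_const:
  assumes "h \<in> bounded_continuous_functions X"
  shows "(\<lambda>x. h x + c) \<in> bounded_continuous_functions X"
proof -
  have "bounded ((\<lambda>x. h x + c) ` topspace X)"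
    using assms by (intro bounded_plus_comp)
      (auto simp: bounded_continuous_functions_def bounded_functions_def image_constant_conv)
  with assms show ?thesis
    by (auto simp: bounded_continuous_functions_def bounded_functions_def
        intro!: continuous_map_add)
qed

theorem theorem2p9:
  fixes X :: "'a topology" and f g :: "'a \<Rightarrow> real"
  assumes "normal_space X"
    and "f \<in> USC X" and "g \<in> LSC X"
    and "pointwise_le X f g"
  shows "\<exists>h \<in> bounded_continuous_functions X. pointwise_le X f h \<and> pointwise_le X h g"
proof -
  define P where "P n h \<longleftrightarrow> h \<in> bounded_continuous_functions X \<and>
    (\<forall>x \<in> topspace X. f x - (1/2)^n \<le> h x \<and> h x \<le> g x + (1/2)^n)" for n :: nat and h
  \<comment> \<open>The factor 2 rounds up the actual 3/2.\<close>
  define Q where "Q n h k \<longleftrightarrow> (\<forall>x \<in> topspace X. \<bar>k x - h x\<bar> \<le> 2 * (1/2)^n)"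
    for n :: nat and h k :: "'a \<Rightarrow> real"
  have "\<exists>h. \<forall>n. P n (h n) \<and> Q n (h n) (h (Suc n))"
  proof (rule dependent_nat_choice)
    show "\<exists>h. P 0 h"
      using approximate_insertion [OF assms(1) zero_less_one assms(2-4)]
      unfolding P_def by (metis power_0)
    fix h n assume h: "P n h"
    define \<epsilon> :: real where "\<epsilon> = (1/2)^n"
    define f' where "f' x = max (f x) (h x + - \<epsilon>)" for x
    define g' where "g' x = min (g x) (h x + \<epsilon>)" for x
    have "\<epsilon> > 0"
      by (simp add: \<epsilon>_def)
    have h_shift: "(\<lambda>x. h x + c) \<in> USC X \<inter> LSC X" for c
      using h bounded_continuous_functions_add_const [of h X c]
      by (simp add: P_def bounded_continuous_functions_eq)
    have "f' \<in> USC X" "g' \<in> LSC X"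
      using USC_max [OF assms(2), of "\<lambda>x. h x + - \<epsilon>"] LSC_min [OF assms(3), of "\<lambda>x. h x + \<epsilon>"]
        h_shift unfolding f'_def g'_def by blast+
    \<comment> \<open>Of the four inequalities needed, \<open>f \<le> h + \<epsilon>\<close> and
      \<open>h - \<epsilon> \<le> g\<close> are exactly what \<open>P n h\<close> supplies.\<close>
    moreover have "pointwise_le X f' g'"
      using h assms(4) \<open>\<epsilon> > 0\<close>
      by (force simp: P_def pointwise_le_def f'_def g'_def simp flip: \<epsilon>_def)
    ultimately obtain k where kb: "k \<in> bounded_continuous_functions X"
      and k: "\<And>x. x \<in> topspace X \<Longrightarrow> f' x - \<epsilon>/2 \<le> k x \<and> k x \<le> g' x + \<epsilon>/2"
      using approximate_insertion [OF assms(1)] half_gt_zero [OF \<open>\<epsilon> > 0\<close>] by metis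
    have "f x - \<epsilon>/2 \<le> k x \<and> k x \<le> g x + \<epsilon>/2 \<and> \<bar>k x - h x\<bar> \<le> 2 * \<epsilon>"
      if "x \<in> topspace X" for x
      using k [OF that] \<open>\<epsilon> > 0\<close> unfolding f'_def g'_def by linarith
    with kb show "\<exists>k. P (Suc n) k \<and> Q n h k"
      by (auto simp: P_def Q_def \<epsilon>_def)
  qed
  then obtain h where h: "\<And>n. P n (h n)" and Q: "\<And>n. Q n (h n) (h (Suc n))"
    by blast
  \<comment> \<open>The right-hand side is the exact sum of the bounds \<open>2 * (1/2)^j\<close>
    for \<open>m \<le> j < m + i\<close>; the subtracted term makes the induction close.\<close>
  have dist_le: "dist (h (m + i) x) (h m x) \<le> 4 * (1/2)^m - 4 * (1/2)^(m + i)"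
    if "x \<in> topspace X" for m i x
  proof (induction i)
    case (Suc i)
    have "\<bar>h (Suc (m + i)) x - h (m + i) x\<bar> \<le> 2 * (1/2)^(m + i)"
      using Q that by (simp add: Q_def)
    with Suc show ?case
      unfolding dist_real_def add_Suc_right power_Suc by linarith
  qed simp
  have pow_small: "\<forall>\<^sub>F n in sequentially. (1/2)^n < \<epsilon>" if "\<epsilon> > 0" for \<epsilon> :: real
    using Archimedean_eventually_pow_inverse [of "1/2" \<epsilon>] that by simp
  obtain l where contl: "continuous_map X euclideanreal l"
    and l: "\<And>\<epsilon>. 0 < \<epsilon> \<Longrightarrow> \<forall>\<^sub>F n in sequentially. \<forall>x\<in>topspace X. dist (h n x) (l x) < \<epsilon>"
  proof (rule Met_TC.continuous_map_uniformly_Cauchy_limit)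
    show "\<forall>\<^sub>F n in sequentially. continuous_map X Met_TC.mtopology (h n)"
      using h by (simp add: P_def bounded_continuous_functions_def)
    fix \<epsilon> :: real assume "\<epsilon> > 0"
    \<comment> \<open>With \<open>\<epsilon>/8\<close> the factor 4 above gives distance below
      \<open>\<epsilon>/2\<close> from \<open>h N\<close>, hence below \<open>\<epsilon>\<close>
      between any two later terms.\<close>
    then obtain N where N: "(1/2)^N < \<epsilon>/8"
      using pow_small [of "\<epsilon>/8"] by (auto simp: eventually_sequentially)
    have "dist (h n x) (h N x) < \<epsilon>/2" if "N \<le> n" "x \<in> topspace X" for n x
    proof -
      have "dist (h n x) (h N x) \<le> 4 * (1/2)^N - 4 * (1/2)^n"
        using dist_le [of x N "n - N"] that by simp
      moreover have "(0::real) \<le> (1/2)^n"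
        by simp
      ultimately show ?thesis
        using N by linarith
    qed
    then show "\<exists>N. \<forall>m n x. N \<le> m \<longrightarrow> N \<le> n \<longrightarrow> x \<in> topspace X \<longrightarrow> dist (h m x) (h n x) < \<epsilon>"
      by (meson dist_triangle_half_l)
  qed (use that in auto)
  have between: "f x \<le> l x" "l x \<le> g x" if "x \<in> topspace X" for x
  proof -
    have "f x - \<epsilon> \<le> l x \<and> l x \<le> g x + \<epsilon>" if "\<epsilon> > 0" for \<epsilon>
    proof -
      \<comment> \<open>Half of \<open>\<epsilon>\<close> covers the error of \<open>h n\<close>
        against \<open>f\<close> and \<open>g\<close>, the other half its distance from the
        limit.\<close>
      have "\<forall>\<^sub>F n in sequentially. (1/2)^n < \<epsilon>/2 \<and> (\<forall>x\<in>topspace X. dist (h n x) (l x) < \<epsilon>/2)"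
        using pow_small [of "\<epsilon>/2"] l [of "\<epsilon>/2"] that by (intro eventually_conj) auto
      then obtain n where "(1/2)^n < \<epsilon>/2" "dist (h n x) (l x) < \<epsilon>/2"
        using \<open>x \<in> topspace X\<close> by (auto simp: eventually_sequentially)
      moreover have "f x - (1/2)^n \<le> h n x" "h n x \<le> g x + (1/2)^n"
        using h \<open>x \<in> topspace X\<close> by (auto simp: P_def)
      ultimately show ?thesis
        unfolding dist_real_def by linarith
    qed
    then show "f x \<le> l x" "l x \<le> g x"
      by (metis field_le_epsilon diff_le_eq)+
  qed
  \<comment> \<open>Boundedness of \<open>l\<close> follows from its position between
    \<open>f\<close> and \<open>g\<close>.\<close>
  have "bounded ((\<lambda>x. max \<bar>f x\<bar> \<bar>g x\<bar>) ` topspace X)"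
    using assms(2,3)
    by (intro bounded_image_max_min) (auto simp: USC_def LSC_def bounded_functions_def bounded_iff)
  then obtain B where B: "\<And>x. x \<in> topspace X \<Longrightarrow> \<bar>max \<bar>f x\<bar> \<bar>g x\<bar>\<bar> \<le> B"
    by (auto simp: bounded_iff)
  have "\<bar>l x\<bar> \<le> B" if "x \<in> topspace X" for x
    using between [OF that] B [OF that] by linarith
  then have "bounded (l ` topspace X)"
    by (auto simp: bounded_iff)
  with contl between show ?thesis
    by (auto simp: bounded_continuous_functions_def bounded_functions_def pointwise_le_def)
qed

end
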